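(* Let $G$ be a connected graph with $\gamma_I^p(G)>2$. Then $\gamma_I^p(G)=3$ if and only if $G$ has a 2-fair dominating set of size $3$.
   Context: All graphs are finite, simple and undirected. For a graph $G=(V,E)$ and $v\in V$, $N(v)$ denotes the set of neighbours of $v$. A perfect Italian dominating function (PID-function) of $G$ is a function $f:V\to\{0,1,2\}$ such that for every vertex $v$ with $f(v)=0$ one has $\sum_{u\in N(v)} f(u)=2$. The weight of $f$ is $\sum_{v\in V} f(v)$; $\gamma_I^p(G)$ is the minimum weight of a PID-function of $G$. For $k\ge1$, a $k$-fair dominating set of $G$ is a dominating set $D\subseteq V$ such that $|N(v)\cap D|=k$ for every $v\in V\setminus D$. *)

theory Defs
  imports "Graph_Theory.Graph_Theory"
begin

text \<open>
  Finite simple undirected graphs are the locale \<open>graph\<close> of the library: finite symmetric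
  digraphs without loops and parallel arcs, an edge \<open>uv\<close> being the pair of opposite arcs
  \<open>(u, v)\<close>, \<open>(v, u)\<close>. The library's \<open>connected\<close> includes nonemptiness of the vertex set.
\<close>

definition neighbours :: "('a, 'b) pre_digraph \<Rightarrow> 'a \<Rightarrow> 'a set" where
  "neighbours G v = {u. v \<rightarrow>\<^bsub>G\<^esub> u}"

text \<open>Only the values of \<open>f\<close> on the vertices of \<open>G\<close> matter in the next two definitions.\<close>

definition PID_function :: "('a, 'b) pre_digraph \<Rightarrow> ('a \<Rightarrow> nat) \<Rightarrow> bool" where
  "PID_function G f \<longleftrightarrow>
     (\<forall>v \<in> verts G. f v \<in> {0, 1, 2}) \<and>
     (\<forall>v \<in> verts G. f v = 0 \<longrightarrow> (\<Sum>u \<in> neighbours G v. f u) = 2)"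

definition weight :: "('a, 'b) pre_digraph \<Rightarrow> ('a \<Rightarrow> nat) \<Rightarrow> nat" where
  "weight G f = (\<Sum>v \<in> verts G. f v)"

definition PID_number :: "('a, 'b) pre_digraph \<Rightarrow> nat" where
  "PID_number G = (LEAST w. \<exists>f. PID_function G f \<and> weight G f = w)"

text \<open>The minimum exists, since the constant function 1 is a PID-function.\<close>

lemma PID_number_attained: "\<exists>f. PID_function G f \<and> weight G f = PID_number G"
proof -
  have "PID_function G (\<lambda>_. 1)"
    by (simp add: PID_function_def)
  then have "\<exists>w f. PID_function G f \<and> weight G f = w"
    by blast
  then show ?thesis
    unfolding PID_number_def by (rule LeastI_ex)
qed

lemma PID_number_le: "PID_function G f \<Longrightarrow> PID_number G \<le> weight G f"
  unfolding PID_number_def by (rule Least_le) blast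

definition dominating_set :: "('a, 'b) pre_digraph \<Rightarrow> 'a set \<Rightarrow> bool" where
  "dominating_set G D \<longleftrightarrow>
     D \<subseteq> verts G \<and> (\<forall>v \<in> verts G - D. neighbours G v \<inter> D \<noteq> {})"

definition fair_dominating_set :: "nat \<Rightarrow> ('a, 'b) pre_digraph \<Rightarrow> 'a set \<Rightarrow> bool" where
  "fair_dominating_set k G D \<longleftrightarrow>
     dominating_set G D \<and> (\<forall>v \<in> verts G - D. card (neighbours G v \<inter> D) = k)"

end

theory Submission
  imports Defs
begin

text \<open>
  A PID-function of weight 3 either has values at most 1, and then its support is a 2-fair
  dominating set, or it takes the value 2 at one vertex \<open>a\<close>, 1 at another vertex \<open>b\<close> and 0
  elsewhere. In the latter case every further vertex is adjacent to \<open>a\<close> but not to \<open>b\<close>, so by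
  connectedness \<open>b\<close> is adjacent to \<open>a\<close> too. Hence assigning 2 to \<open>a\<close> alone gives a PID-function
  of weight 2.
\<close>

lemma neighbours_subset_verts:
  assumes "wf_digraph G"
  shows "neighbours G v \<subseteq> verts G"
  using wf_digraph.adj_in_verts(2)[OF assms] by (auto simp: neighbours_def)

lemma finite_neighbours:
  assumes "graph G"
  shows "finite (neighbours G v)"
proof -
  interpret graph G by fact
  show ?thesis
    using neighbours_subset_verts[OF wf_digraph_axioms] finite_verts by (rule finite_subset)
qed

text \<open>A walk from \<open>b\<close> to the different vertex \<open>a\<close> has a first arc,
  and the head of that arc is a neighbour of \<open>b\<close>.\<close>

lemma connected_neighbour_exists:
  assumes "graph G" "Digraph_Component.connected G"
    and "a \<in> verts G" "b \<in> verts G" "a \<noteq> b"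
  shows "neighbours G b \<noteq> {}"
proof -
  interpret graph G by fact
  have "b \<rightarrow>\<^sup>*\<^bsub>mk_symmetric G\<^esub> a"
    using assms(2-4) by (simp add: Digraph_Component.connected_def strongly_connected_def)
  \<comment> \<open>Connectedness speaks of the symmetric closure; the arcs of \<open>G\<close> are
    already symmetric, so reachability is the same in both.\<close>
  then have "b \<rightarrow>\<^sup>*\<^bsub>G\<^esub> a"
    by (simp add: reachable_mk_symmetric_eq sym_arcs)
  then show ?thesis
    using assms(5) by (cases rule: converse_reachable_cases) (auto simp: neighbours_def)
qed

lemma sum_of_bool_nat:
  fixes A D :: "'a set"
  assumes "finite A"
  shows "(\<Sum>v\<in>A. of_bool (v \<in> D)) = card (A \<inter> D)"
proof -
  have "A \<inter> {v. v \<in> D} = A \<inter> D" by auto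
  with assms show ?thesis by (simp add: of_bool_def sum.If_cases)
qed

text \<open>Exactly the vertices outside \<open>D\<close> get value 0, and the neighbour sum of an
  indicator counts the neighbours in \<open>D\<close>, so 2-fairness is the PID condition.\<close>

lemma PID_function_indicator:
  assumes "graph G" "fair_dominating_set 2 G D"
  shows "PID_function G (\<lambda>v. of_bool (v \<in> D))"
  using assms(2)
  by (auto simp: PID_function_def fair_dominating_set_def sum_of_bool_nat
      finite_neighbours[OF assms(1)])

lemma weight_indicator:
  assumes "finite (verts G)" "D \<subseteq> verts G"
  shows "weight G (\<lambda>v. of_bool (v \<in> D)) = card D"
  using assms by (simp add: weight_def sum_of_bool_nat Int_absorb1)

lemma fair_dominating_set_support:
  assumes "graph G" "PID_function G f" "\<And>v. v \<in> verts G \<Longrightarrow> f v \<le> 1"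
  defines "D \<equiv> {v \<in> verts G. f v = 1}"
  shows "fair_dominating_set 2 G D" "card D = weight G f"
proof -
  interpret graph G by fact
  \<comment> \<open>\<open>f\<close> is arbitrary off the vertex set, so it agrees with the
    indicator of \<open>D\<close> only on \<open>verts G\<close>; this suffices, as neighbours are
    vertices.\<close>
  have f: "f v = of_bool (v \<in> D)" if "v \<in> verts G" for v
    using assms(3)[OF that] that by (cases "f v") (auto simp: D_def)
  have "card (neighbours G v \<inter> D) = 2" if v: "v \<in> verts G - D" for v
  proof -
    have "f v = 0"
      using f v by simp
    then have "(\<Sum>u\<in>neighbours G v. f u) = 2"
      using assms(2) v by (simp add: PID_function_def)
    moreover have "(\<Sum>u\<in>neighbours G v. f u) = (\<Sum>u\<in>neighbours G v. of_bool (u \<in> D))"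
      using neighbours_subset_verts[OF wf_digraph_axioms] f by (intro sum.cong) blast+
    ultimately show ?thesis
      by (simp add: sum_of_bool_nat finite_neighbours[OF assms(1)])
  qed
  \<comment> \<open>Domination comes for free: a set of cardinality 2 is nonempty.\<close>
  then show "fair_dominating_set 2 G D"
    by (fastforce simp: fair_dominating_set_def dominating_set_def D_def)
  have "weight G f = weight G (\<lambda>v. of_bool (v \<in> D))"
    using f by (auto simp: weight_def intro: sum.cong)
  then show "card D = weight G f"
    using weight_indicator[of G D] by (simp add: D_def)
qed

text \<open>Put 2 on \<open>a\<close> and 0 elsewhere: every other vertex receives its neighbour sum
  2 from \<open>a\<close> alone.\<close>

lemma PID_number_le_2_universal_vertex:
  assumes "graph G" "a \<in> verts G" "\<And>v. v \<in> verts G \<Longrightarrow> v \<noteq> a \<Longrightarrow> a \<in> neighbours G v"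
  shows "PID_number G \<le> 2"
proof -
  interpret graph G by fact
  let ?g = "\<lambda>v. if v = a then 2 else 0 :: nat"
  have "PID_function G ?g"
    using assms(3) by (auto simp: PID_function_def finite_neighbours[OF assms(1)])
  moreover have "weight G ?g = 2"
    using assms(2) by (simp add: weight_def)
  ultimately show ?thesis
    using PID_number_le by metis
qed

lemma PID_number_le_2_if_value_2:
  assumes "graph G" "Digraph_Component.connected G" "PID_function G f" "weight G f = 3"
    and a: "a \<in> verts G" "f a = 2"
  shows "PID_number G \<le> 2"
proof -
  interpret graph G by fact
  \<comment> \<open>Removing the 2 at \<open>a\<close> leaves weight 1, which natural numbers can
    only make up by a single 1, at \<open>b\<close>, and zeros.\<close>
  have "(\<Sum>v\<in>verts G - {a}. f v) = 1"
    using assms(4) a by (simp add: weight_def sum.remove)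
  then have "\<exists>b\<in>verts G - {a}. f b = 1 \<and> (\<forall>v\<in>verts G - {a}. b \<noteq> v \<longrightarrow> f v = 0)"
    by (subst (asm) sum_eq_1_iff) auto
  then obtain b where b: "b \<in> verts G" "b \<noteq> a" "f b = 1"
    and b_unique: "\<forall>v\<in>verts G - {a}. b \<noteq> v \<longrightarrow> f v = 0"
    by auto
  have zero: "f v = 0" if "v \<in> verts G" "v \<noteq> a" "v \<noteq> b" for v
    using b_unique that by auto
  have sub: "neighbours G v \<subseteq> verts G" for v
    by (rule neighbours_subset_verts[OF wf_digraph_axioms])
  have other: "a \<in> neighbours G v \<and> b \<notin> neighbours G v"
    if v: "v \<in> verts G" "v \<noteq> a" "v \<noteq> b" for v
  proof -
    let ?N = "neighbours G v"
    have "2 = (\<Sum>u\<in>?N. f u)"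
      using assms(3) zero[OF v] v(1) by (simp add: PID_function_def)
    also have "\<dots> = (\<Sum>u\<in>?N \<inter> {a, b}. f u)"
      using b_unique sub[of v]
      by (intro sum.mono_neutral_right finite_neighbours[OF assms(1)]) auto
    also have "\<dots> = (if a \<in> ?N then 2 else 0) + (if b \<in> ?N then 1 else 0)"
      using a b by (simp add: Int_insert_right)
    \<comment> \<open>Of the four possible totals 0, 1, 2, 3, the value 2 occurs only with
      \<open>a\<close> present and \<open>b\<close> absent.\<close>
    finally show ?thesis
      by (auto split: if_splits)
  qed
  obtain u where u: "u \<in> neighbours G b"
    using connected_neighbour_exists[OF assms(1,2) a(1) b(1)] b(2) by auto
  \<comment> \<open>By symmetry \<open>u\<close> is adjacent to \<open>b\<close>, which
    \<open>other\<close> excludes for every vertex apart from \<open>a\<close> and \<open>b\<close>;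
    there are no loops, so only \<open>a\<close> remains.\<close>
  then have "b \<in> neighbours G u"
    using sym_arcs by (simp add: neighbours_def arcs_ends_symmetric)
  moreover have "u \<noteq> b"
    using u adj_not_same by (auto simp: neighbours_def)
  ultimately have "u = a"
    using other u sub by blast
  then show ?thesis
    using other u by (intro PID_number_le_2_universal_vertex[OF assms(1) a(1)]) metis
qed

theorem theorem13:
  fixes G :: "('a, 'b) pre_digraph"
  assumes "graph G"
    and "Digraph_Component.connected G"
    and "PID_number G > 2"
  shows "PID_number G = 3 \<longleftrightarrow> (\<exists>D. fair_dominating_set 2 G D \<and> card D = 3)"
proof
  assume "PID_number G = 3"
  then obtain f where f: "PID_function G f" "weight G f = 3"
    using PID_number_attained by metis
  have "f v \<le> 1" if "v \<in> verts G" for v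
  proof -
    have "f v \<noteq> 2"
      using PID_number_le_2_if_value_2[OF assms(1,2) f that] assms(3) by auto
    moreover have "f v \<in> {0, 1, 2}"
      using f(1) that by (simp add: PID_function_def)
    ultimately show ?thesis
      by auto
  qed
  then show "\<exists>D. fair_dominating_set 2 G D \<and> card D = 3"
    using fair_dominating_set_support[OF assms(1) f(1)] f(2) by auto
next
  interpret graph G by fact
  assume "\<exists>D. fair_dominating_set 2 G D \<and> card D = 3"
  then obtain D where D: "fair_dominating_set 2 G D" "card D = 3"
    by blast
  then have "weight G (\<lambda>v. of_bool (v \<in> D)) = 3"
    by (simp add: weight_indicator fair_dominating_set_def dominating_set_def)
  \<comment> \<open>The indicator of \<open>D\<close> witnesses the upper bound; the assumption
    \<open>PID_number G > 2\<close> supplies the matching lower bound.\<close>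
  then have "PID_number G \<le> 3"
    using PID_number_le[OF PID_function_indicator[OF assms(1) D(1)]] by simp
  with assms(3) show "PID_number G = 3"
    by simp
qed

end
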